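(* Let $R$ be a commutative Noetherian ring that is a unique factorization domain. Let $n\ge 1$, let $p_1,\dots,p_n\in R$ be pairwise non-associate irreducible elements, and let $\mathbf a=(a_1,\dots,a_n)$ and $\mathbf b=(b_1,\dots,b_n)$ be fan ordered strings of non-negative integers. Let $I=(p_1^{a_1}\cdots p_n^{a_n})$ and $J=(p_1^{b_1}\cdots p_n^{b_n})$. Let $\Sigma_{\mathbf a,\mathbf b}=\{C_0,\dots,C_n\}$ be the fan of $\mathbf a$ and $\mathbf b$, and for each $i=0,\dots,n$ let $Q_i=C_i\cap\mathbb{Z}^2$, with Hilbert basis $\mathcal{H}_{Q_i}=\{(r_{i1},s_{i1}),\dots,(r_{in_i},s_{in_i})\}$. Then the intersection algebra $\mathcal{B}=\mathcal{B}_R(I,J)$ is generated as an algebra over $R$ by the set $$\{\,p_1^{a_1r_{ij}}\cdots p_i^{a_ir_{ij}}\,p_{i+1}^{b_{i+1}s_{ij}}\cdots p_n^{b_ns_{ij}}\,u^{r_{ij}}v^{s_{ij}} \;:\; i=0,\dots,n,\ j=1,\dots,n_i\,\}.$$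
   Context: $\mathbb{N}$ denotes the non-negative integers. Intersection algebra: for ideals $I,J$ of a commutative Noetherian ring $R$, $$\mathcal{B}_R(I,J)=\sum_{r,s\in\mathbb{N}}(I^r\cap J^s)\,u^rv^s\subseteq R[u,v],$$ an $\mathbb{N}^2$-graded $R$-subalgebra of the polynomial ring $R[u,v]$ in two indeterminates, where $I^0=J^0=R$. Fan: two strings $\mathbf a=(a_1,\dots,a_n)$, $\mathbf b=(b_1,\dots,b_n)$ of non-negative integers, with $a_i,b_i$ not both zero for each $i$, are called fan ordered if $\frac{a_i}{b_i}\ge\frac{a_{i+1}}{b_{i+1}}$ for all $i=1,\dots,n-1$ (ratios taken in $[0,\infty]$, with $a/0=\infty$ for $a>0$). Put additionally $a_0=1$, $b_0=0$, $a_{n+1}=0$, $b_{n+1}=1$. For $i=0,\dots,n$ let $$C_i=\{\lambda_1(b_i,a_i)+\lambda_2(b_{i+1},a_{i+1}) : \lambda_1,\lambda_2\in\mathbb{R}_{\ge0}\}\subset\mathbb{R}^2.$$ The fan of $\mathbf a$ and $\mathbf b$ is $\Sigma_{\mathbf a,\mathbf b}=\{C_i : i=0,\dots,n\}$ (together with the faces of these cones). Hilbert basis: each $Q_i=C_i\cap\mathbb{Z}^2$ is a pointed affine semigroup (a finitely generated submonoid of $\mathbb{Z}^2$ whose only invertible element is $0$), and its Hilbert basis $\mathcal{H}_{Q_i}$ is its unique finite minimal generating set (as a monoid). *)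

theory Defs
  imports
    Complex_Main
    "HOL-Library.Poly_Mapping"
    "HOL-Library.Product_Plus"
    "HOL-Library.Extended_Nonnegative_Real"
    "Berlekamp_Zassenhaus.Unique_Factorization"
begin

abbreviation ring_ideal :: "'a::comm_ring_1 set \<Rightarrow> bool" where
  "ring_ideal \<equiv> Modules.module.subspace ((*) :: 'a \<Rightarrow> 'a \<Rightarrow> 'a)"

abbreviation ideal_span :: "'a::comm_ring_1 set \<Rightarrow> 'a set" where
  "ideal_span \<equiv> Modules.module.span ((*) :: 'a \<Rightarrow> 'a \<Rightarrow> 'a)"

definition noetherian :: "'a::comm_ring_1 itself \<Rightarrow> bool" where
  "noetherian _ \<longleftrightarrow> (\<forall>I::'a set. ring_ideal I \<longrightarrow> (\<exists>S. finite S \<and> I = ideal_span S))"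

definition ideal_mult :: "'a::comm_ring_1 set \<Rightarrow> 'a set \<Rightarrow> 'a set" where
  "ideal_mult I J = ideal_span {x * y | x y. x \<in> I \<and> y \<in> J}"

primrec ideal_power :: "'a::comm_ring_1 set \<Rightarrow> nat \<Rightarrow> 'a set" where
  "ideal_power I 0 = UNIV"
| "ideal_power I (Suc r) = ideal_mult I (ideal_power I r)"

text \<open>The polynomial ring \<open>R[u,v]\<close>: finitely supported coefficient functions on pairs of exponents,
  with convolution as multiplication. The term \<open>c u^r v^s\<close> is \<open>Poly_Mapping.single (r, s) c\<close>.\<close>

type_synonym 'a poly_uv = "(nat \<times> nat) \<Rightarrow>\<^sub>0 'a"

definition term_uv :: "'a::comm_ring_1 \<Rightarrow> nat \<Rightarrow> nat \<Rightarrow> 'a poly_uv" where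
  "term_uv c r s = Poly_Mapping.single (r, s) c"

definition intersection_algebra :: "'a::comm_ring_1 set \<Rightarrow> 'a set \<Rightarrow> 'a poly_uv set" where
  "intersection_algebra I J =
    {\<Sum>(r, s)\<in>A. term_uv (c r s) r s | A c.
      finite A \<and> (\<forall>(r, s)\<in>A. c r s \<in> ideal_power I r \<inter> ideal_power J s)}"

text \<open>Closure under negation is implied, since the constant \<open>-1\<close> is a member.\<close>

definition subalgebra_uv :: "'a::comm_ring_1 poly_uv set \<Rightarrow> bool" where
  "subalgebra_uv B \<longleftrightarrow>
    (\<forall>c. term_uv c 0 0 \<in> B) \<and> (\<forall>f\<in>B. \<forall>g\<in>B. f + g \<in> B) \<and> (\<forall>f\<in>B. \<forall>g\<in>B. f * g \<in> B)"

text \<open>Strings are functions on \<open>nat\<close> of which only the values at \<open>1, \<dots>, n\<close> matter.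
  In \<open>ennreal\<close>, \<open>x / 0 = \<infinity>\<close> for \<open>x > 0\<close>.\<close>

definition fan_ordered :: "nat \<Rightarrow> (nat \<Rightarrow> nat) \<Rightarrow> (nat \<Rightarrow> nat) \<Rightarrow> bool" where
  "fan_ordered n a b \<longleftrightarrow>
    (\<forall>i\<in>{1..n}. \<not> (a i = 0 \<and> b i = 0)) \<and>
    (\<forall>i\<in>{1..<n}. (of_nat (a i) / of_nat (b i) :: ennreal) \<ge> of_nat (a (i + 1)) / of_nat (b (i + 1)))"

definition extend_a :: "nat \<Rightarrow> (nat \<Rightarrow> nat) \<Rightarrow> nat \<Rightarrow> nat" where
  "extend_a n a i = (if i = 0 then 1 else if i = n + 1 then 0 else a i)"

definition extend_b :: "nat \<Rightarrow> (nat \<Rightarrow> nat) \<Rightarrow> nat \<Rightarrow> nat" where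
  "extend_b n b i = (if i = 0 then 0 else if i = n + 1 then 1 else b i)"

definition fan_cone :: "nat \<Rightarrow> (nat \<Rightarrow> nat) \<Rightarrow> (nat \<Rightarrow> nat) \<Rightarrow> nat \<Rightarrow> (real \<times> real) set" where
  "fan_cone n a b i =
    {(l1 * real (extend_b n b i) + l2 * real (extend_b n b (i + 1)),
      l1 * real (extend_a n a i) + l2 * real (extend_a n a (i + 1))) | l1 l2. l1 \<ge> 0 \<and> l2 \<ge> 0}"

definition lattice_points :: "(real \<times> real) set \<Rightarrow> (int \<times> int) set" where
  "lattice_points C = {(r, s). (of_int r, of_int s) \<in> C}"

definition add_submonoid :: "'m::monoid_add set \<Rightarrow> bool" where
  "add_submonoid M \<longleftrightarrow> 0 \<in> M \<and> (\<forall>x\<in>M. \<forall>y\<in>M. x + y \<in> M)"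

text \<open>The unique finite minimal generating set; meaningful for pointed affine semigroups.\<close>

definition hilbert_basis :: "'m::monoid_add set \<Rightarrow> 'm set" where
  "hilbert_basis Q =
    (THE H. finite H \<and> add_submonoid hull H = Q \<and> (\<forall>H'. H' \<subset> H \<longrightarrow> add_submonoid hull H' \<noteq> Q))"

end

theory Submission
  imports Defs
begin

text \<open>
  Both sides are spanned by terms \<open>c u^r v^s\<close>, so everything is decided one bidegree at a time.
  Since \<open>R\<close> is a UFD, the ideal \<open>I^r \<inter> J^s\<close> is principal, generated by the least common multiple
  \<open>\<Prod>k. p k ^ max (a k * r) (b k * s)\<close> of the generators of \<open>I^r\<close> and \<open>J^s\<close>
  (\<open>principal_powers_inter\<close>). The obstacle to generating the algebra from few terms is that
  this exponent is only piecewise linear in \<open>(r, s)\<close>, so that the lcm for a sum of bidegrees is in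
  general a proper divisor of the product of the lcms.

  The fan cuts the quadrant exactly along the break lines \<open>a k * r = b k * s\<close>, whose rays are
  spanned by \<open>(b k, a k)\<close>. On a single cone \<open>C i\<close> the maximum is \<open>a k * r\<close> for \<open>k \<le> i\<close> and
  \<open>b k * s\<close> for \<open>k > i\<close> (\<open>fan_cone_max_exponent\<close>). There it is linear, and the lcm terms are
  multiplicative. So once the terms at the Hilbert basis of the lattice points of \<open>C i\<close> are in a
  subalgebra, the terms at all lattice points of \<open>C i\<close> are
  (\<open>fan_monomials_mem_subalgebra\<close>). The cones cover the quadrant (\<open>fan_covers_quadrant\<close>), so every
  bidegree is reached.

  It remains to see that the description of a Hilbert basis as the unique finite minimal generating
  set does denote a generating set. Lattice points of a cone in the quadrant carry the additive size
  \<open>r + s\<close>, so they are sums of atoms (\<open>atoms_generate\<close>); an atom occurs in every generating set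
  (\<open>atoms_subset_generators\<close>); and by Gordan's argument there are finitely many atoms, because an
  atom with a coefficient above 1 along a ray generator would split off that generator
  (\<open>finite_cone_atoms\<close>).
\<close>

section \<open>Ideals and their powers\<close>

interpretation ring_module: Modules.module "(*) :: 'a::comm_ring_1 \<Rightarrow> 'a \<Rightarrow> 'a"
  by unfold_locales (auto simp: algebra_simps)

lemma ring_ideal_ideal_power: "ring_ideal (ideal_power I r)"
  by (cases r) (auto simp: ideal_mult_def ring_module.subspace_span ring_module.subspace_UNIV)

text \<open>
  For fixed \<open>y\<close>, the \<open>x\<close> with \<open>x * y\<close> in the target form an ideal, so the induction on \<open>r\<close> only has to
  treat the products that span \<open>I^(r + 1)\<close>.
\<close>

lemma ideal_power_mult_mem:
  fixes x y :: "'a::comm_ring_1"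
  assumes "x \<in> ideal_power I r" and "y \<in> ideal_power I s"
  shows "x * y \<in> ideal_power I (r + s)"
  using assms(1)
proof (induction r arbitrary: x)
  case 0
  then show ?case
    using ring_module.subspace_scale[OF ring_ideal_ideal_power assms(2)] by simp
next
  case (Suc r)
  let ?T = "{x. x * y \<in> ideal_power I (Suc r + s)}"
  note ideal = ring_ideal_ideal_power[of I "Suc r + s"]
  have "ring_ideal ?T"
  proof (rule ring_module.subspaceI; unfold mem_Collect_eq)
    show "0 * y \<in> ideal_power I (Suc r + s)"
      using ring_module.subspace_0[OF ideal] by (simp only: mult_zero_left)
    show "(u + v) * y \<in> ideal_power I (Suc r + s)"
      if "u * y \<in> ideal_power I (Suc r + s)" "v * y \<in> ideal_power I (Suc r + s)" for u v
      using ring_module.subspace_add[OF ideal that] by (simp only: distrib_right)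
    show "(c * u) * y \<in> ideal_power I (Suc r + s)" if "u * y \<in> ideal_power I (Suc r + s)" for c u
      using ring_module.subspace_scale[OF ideal that] by (simp only: mult.assoc)
  qed
  moreover have "{z * w | z w. z \<in> I \<and> w \<in> ideal_power I r} \<subseteq> ?T"
  proof clarify
    fix z w assume "z \<in> I" "w \<in> ideal_power I r"
    then have "z * (w * y) \<in> ideal_power I (Suc (r + s))"
      unfolding ideal_power.simps ideal_mult_def using Suc.IH by (intro ring_module.span_base) blast
    then show "z * w * y \<in> ideal_power I (Suc r + s)"
      by (simp only: mult.assoc add_Suc)
  qed
  ultimately have "ideal_power I (Suc r) \<subseteq> ?T"
    unfolding ideal_power.simps(2)[of I r] ideal_mult_def[of I "ideal_power I r"]
    by (intro ring_module.span_minimal)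
  then show ?case
    using Suc.prems by blast
qed

lemma ideal_span_singleton: "ideal_span {g} = {x. g dvd x}"
  by (auto simp: ring_module.span_singleton dvd_def mult.commute)

lemma ideal_power_principal: "ideal_power (ideal_span {g}) r = {x. g ^ r dvd x}"
proof (induction r)
  case (Suc r)
  have "ring_ideal {x. g * g ^ r dvd x}"
    by (auto simp: ring_module.subspace_def)
  then have "ideal_mult {x. g dvd x} {x. g ^ r dvd x} \<subseteq> {x. g * g ^ r dvd x}"
    unfolding ideal_mult_def by (intro ring_module.span_minimal) (auto intro: mult_dvd_mono)
  moreover have "x \<in> ideal_mult {x. g dvd x} {x. g ^ r dvd x}" if "g * g ^ r dvd x" for x
  proof -
    obtain d where "x = g * (g ^ r * d)"
      using \<open>g * g ^ r dvd x\<close> by (metis dvdE mult.assoc)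
    then show ?thesis
      unfolding ideal_mult_def
      by (intro ring_module.span_base CollectI exI[of _ g] exI[of _ "g ^ r * d"]) simp
  qed
  ultimately show ?case
    using Suc.IH by (auto simp: ideal_span_singleton)
qed simp


section \<open>Divisibility by products of prime powers\<close>

lemma prime_elem_dvd_prodD:
  assumes "prime_elem q" and "finite K" and "q dvd prod f K"
  shows "\<exists>k\<in>K. q dvd f k"
  using assms(2,3)
  by (induction K rule: finite_induct)
    (use assms(1) in \<open>auto simp: prime_elem_dvd_mult_iff dest: prime_elem_not_unit\<close>)

text \<open>Each factor \<open>q\<close> of \<open>m * x\<close> must come from \<open>x\<close>, so it can be cancelled there, one at a time.\<close>

lemma prime_elem_power_dvd_multD:
  fixes q :: "'a::idom"
  assumes "prime_elem q" and "\<not> q dvd m" and "q ^ e dvd m * x"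
  shows "q ^ e dvd x"
  using assms(3)
proof (induction e arbitrary: x)
  case (Suc e)
  have "q dvd m * x"
    using Suc.prems by (auto intro: dvd_mult_left)
  then have "q dvd x"
    using assms(1,2) by (simp add: prime_elem_dvd_mult_iff)
  then obtain y where y: "x = q * y" ..
  have "q * q ^ e dvd q * (m * y)"
    using Suc.prems by (simp add: y mult.left_commute)
  then have "q ^ e dvd m * y"
    using assms(1) by auto
  then have "q ^ e dvd y"
    by (rule Suc.IH)
  then show ?case
    unfolding y power_Suc by (rule mult_dvd_mono[OF dvd_refl])
qed simp

text \<open>
  The inductive step splits off one prime: it divides none of the other primes, hence not their
  product, so its whole power must divide the cofactor.
\<close>

lemma prod_prime_powers_dvd:
  fixes p :: "'i \<Rightarrow> 'a::idom"
  assumes "finite K" and "\<And>k. k \<in> K \<Longrightarrow> prime_elem (p k)"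
    and "\<And>j k. j \<in> K \<Longrightarrow> k \<in> K \<Longrightarrow> j \<noteq> k \<Longrightarrow> \<not> p j dvd p k"
    and "\<And>k. k \<in> K \<Longrightarrow> p k ^ e k dvd x"
  shows "(\<Prod>k\<in>K. p k ^ e k) dvd x"
  using assms
proof (induction K rule: finite_induct)
  case (insert j K)
  let ?P = "\<Prod>k\<in>K. p k ^ e k"
  obtain y where y: "x = ?P * y"
    using insert.IH insert.prems by (metis dvdE insertCI)
  have "\<not> p j dvd p k ^ e k" if "k \<in> K" for k
  proof -
    have "j \<noteq> k" using that insert.hyps(2) by blast
    then have "\<not> p j dvd p k" using that by (intro insert.prems(2)) simp_all
    moreover have "prime_elem (p j)" by (rule insert.prems(1)) simp
    ultimately show ?thesis
      using prime_elem_dvd_power[of "p j" "p k" "e k"] by metis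
  qed
  then have "\<not> p j dvd ?P"
    using prime_elem_dvd_prodD[OF insert.prems(1)[of j] insert.hyps(1), of "\<lambda>k. p k ^ e k"] by auto
  then have "p j ^ e j dvd y"
  proof (rule prime_elem_power_dvd_multD[rotated])
    show "prime_elem (p j)"
      using insert.prems(1) by simp
    show "p j ^ e j dvd ?P * y"
      using insert.prems(3)[of j] by (simp add: y)
  qed
  then show ?case
    unfolding y prod.insert[OF insert.hyps] mult.commute[of ?P] by (rule mult_dvd_mono) simp
qed simp

text \<open>
  Intersecting principal ideals means taking the least common multiple, which for products of
  powers of the same primes takes the maximum of the exponents.
\<close>

lemma principal_powers_inter:
  fixes p :: "'i \<Rightarrow> 'a::idom"
  assumes "finite K" and "\<And>k. k \<in> K \<Longrightarrow> prime_elem (p k)"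
    and "\<And>j k. j \<in> K \<Longrightarrow> k \<in> K \<Longrightarrow> j \<noteq> k \<Longrightarrow> \<not> p j dvd p k"
  shows "ideal_power (ideal_span {\<Prod>k\<in>K. p k ^ a k}) r \<inter>
           ideal_power (ideal_span {\<Prod>k\<in>K. p k ^ b k}) s =
         {x. (\<Prod>k\<in>K. p k ^ max (a k * r) (b k * s)) dvd x}"
proof -
  have pow: "(\<Prod>k\<in>K. p k ^ c k) ^ t = (\<Prod>k\<in>K. p k ^ (c k * t))" for c t
    by (simp add: prod_power_distrib power_mult)
  have "(\<Prod>k\<in>K. p k ^ max (a k * r) (b k * s)) dvd x"
    if x: "(\<Prod>k\<in>K. p k ^ (a k * r)) dvd x" "(\<Prod>k\<in>K. p k ^ (b k * s)) dvd x" for x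
  proof (rule prod_prime_powers_dvd[OF assms])
    fix k assume "k \<in> K"
    then have "p k ^ (a k * r) dvd x" "p k ^ (b k * s) dvd x"
      using x assms(1) by (meson dvd_prodI dvd_trans)+
    then show "p k ^ max (a k * r) (b k * s) dvd x"
      by (simp add: max_def)
  qed
  moreover have "(\<Prod>k\<in>K. p k ^ (a k * r)) dvd (\<Prod>k\<in>K. p k ^ max (a k * r) (b k * s))"
    "(\<Prod>k\<in>K. p k ^ (b k * s)) dvd (\<Prod>k\<in>K. p k ^ max (a k * r) (b k * s))"
    by (auto intro!: prod_dvd_prod le_imp_power_dvd)
  ultimately show ?thesis
    by (auto simp: ideal_power_principal pow intro: dvd_trans)
qed


section \<open>The intersection algebra, coefficient by coefficient\<close>

lemma poly_uv_expand: "f = (\<Sum>(r, s)\<in>Poly_Mapping.keys f. term_uv (Poly_Mapping.lookup f (r, s)) r s)"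
  by (rule poly_mapping_eqI)
    (simp add: lookup_sum term_uv_def split_beta lookup_single when_def not_in_keys_iff_lookup_eq_zero)

lemma term_uv_mult: "term_uv c r s * term_uv d r' s' = term_uv (c * d) (r + r') (s + s')"
  by (simp add: term_uv_def mult_single)

text \<open>
  A bidegree outside the index set of a representation has coefficient 0, which lies in every ideal;
  conversely the support of \<open>f\<close> serves as index set. This form makes closure under addition
  immediate.
\<close>

lemma mem_intersection_algebra_iff:
  "f \<in> intersection_algebra I J \<longleftrightarrow>
    (\<forall>r s. Poly_Mapping.lookup f (r, s) \<in> ideal_power I r \<inter> ideal_power J s)"
proof
  assume "f \<in> intersection_algebra I J"
  then obtain A c where A: "finite A" "\<forall>(r, s)\<in>A. c r s \<in> ideal_power I r \<inter> ideal_power J s"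
    and f: "f = (\<Sum>(r, s)\<in>A. term_uv (c r s) r s)"
    unfolding intersection_algebra_def by blast
  show "\<forall>r s. Poly_Mapping.lookup f (r, s) \<in> ideal_power I r \<inter> ideal_power J s"
  proof (intro allI)
    fix r s
    have "ring_ideal (ideal_power I r \<inter> ideal_power J s)"
      by (intro ring_module.subspace_inter ring_ideal_ideal_power)
    moreover have "Poly_Mapping.lookup f (r, s) = (if (r, s) \<in> A then c r s else 0)"
      using A(1) by (simp add: f lookup_sum term_uv_def split_beta lookup_single when_def)
    ultimately show "Poly_Mapping.lookup f (r, s) \<in> ideal_power I r \<inter> ideal_power J s"
      using A(2) ring_module.subspace_0 by auto
  qed
next
  assume "\<forall>r s. Poly_Mapping.lookup f (r, s) \<in> ideal_power I r \<inter> ideal_power J s"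
  then show "f \<in> intersection_algebra I J"
    unfolding intersection_algebra_def
    by (intro CollectI exI[of _ "Poly_Mapping.keys f"] exI[of _ "\<lambda>r s. Poly_Mapping.lookup f (r, s)"]
        conjI poly_uv_expand finite_keys) blast
qed

lemma term_uv_mem_intersection_algebra:
  assumes "c \<in> ideal_power I r \<inter> ideal_power J s"
  shows "term_uv c r s \<in> intersection_algebra I J"
  unfolding intersection_algebra_def using assms
  by (intro CollectI exI[of _ "{(r, s)}"] exI[of _ "\<lambda>_ _. c"]) auto

lemma subalgebra_uv_scale: "subalgebra_uv B \<Longrightarrow> f \<in> B \<Longrightarrow> term_uv c 0 0 * f \<in> B"
  unfolding subalgebra_uv_def by blast

lemma sum_mem_subalgebra_uv:
  assumes "subalgebra_uv B" and "\<And>x. x \<in> A \<Longrightarrow> f x \<in> B"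
  shows "sum f A \<in> B"
proof -
  have "0 \<in> B"
    using assms(1) unfolding subalgebra_uv_def term_uv_def by (metis single_zero)
  with assms show ?thesis
    by (induction A rule: infinite_finite_induct) (auto simp: subalgebra_uv_def)
qed

text \<open>
  For products it suffices to multiply two terms, where the coefficient lies in the right ideals
  because \<open>I^r I^r' \<subseteq> I^(r + r')\<close>.
\<close>

lemma subalgebra_uv_intersection_algebra: "subalgebra_uv (intersection_algebra I J)"
proof -
  let ?B = "intersection_algebra I J"
  have ideal: "ring_ideal (ideal_power I r \<inter> ideal_power J s)" for r s
    by (intro ring_module.subspace_inter ring_ideal_ideal_power)
  have add: "f + g \<in> ?B" if "f \<in> ?B" "g \<in> ?B" for f g
    using that ring_module.subspace_add[OF ideal]
    unfolding mem_intersection_algebra_iff lookup_add by blast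
  have zero: "0 \<in> ?B"
    using ring_module.subspace_0[OF ideal] by (simp add: mem_intersection_algebra_iff)
  have sum: "sum h A \<in> ?B" if "\<And>x. x \<in> A \<Longrightarrow> h x \<in> ?B" for h :: "nat \<times> nat \<Rightarrow> _" and A
    using that by (induction A rule: infinite_finite_induct) (auto simp: add zero)
  have "f * g \<in> ?B" if f: "f \<in> ?B" and g: "g \<in> ?B" for f g
  proof -
    let ?f = "Poly_Mapping.lookup f" and ?g = "Poly_Mapping.lookup g"
    have "f * g = (\<Sum>(r, s)\<in>Poly_Mapping.keys f. \<Sum>(r', s')\<in>Poly_Mapping.keys g.
        term_uv (?f (r, s) * ?g (r', s')) (r + r') (s + s'))"
      by (subst poly_uv_expand[of f], subst poly_uv_expand[of g])
        (simp add: sum_product split_beta term_uv_mult)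
    also have "\<dots> \<in> ?B"
      using f[unfolded mem_intersection_algebra_iff] g[unfolded mem_intersection_algebra_iff]
      by (auto simp: split_beta intro!: sum term_uv_mem_intersection_algebra ideal_power_mult_mem)
    finally show ?thesis .
  qed
  moreover have "term_uv c 0 0 \<in> ?B" for c
    by (rule term_uv_mem_intersection_algebra) simp
  ultimately show ?thesis
    using add by (simp add: subalgebra_uv_def)
qed

lemma subalgebra_uv_hull: "subalgebra_uv (subalgebra_uv hull S)"
proof (rule hull_in)
  fix T assume "Ball T subalgebra_uv"
  then have "\<forall>B\<in>T. subalgebra_uv B" by blast
  then show "subalgebra_uv (\<Inter>T)"
    unfolding subalgebra_uv_def by (intro conjI allI ballI InterI; meson InterD)
qed


section \<open>Hilbert bases\<close>

text \<open>
  The irreducible elements of a monoid in which \<open>0\<close> is the only unit.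
\<close>

definition atoms :: "'m::monoid_add set \<Rightarrow> 'm set" where
  "atoms M = {x \<in> M. x \<noteq> 0 \<and> (\<forall>y\<in>M. \<forall>z\<in>M. x = y + z \<longrightarrow> y = 0 \<or> z = 0)}"

lemma add_submonoid_hull: "add_submonoid (add_submonoid hull H)"
proof (rule hull_in)
  fix T assume "Ball T add_submonoid"
  then have "\<forall>B\<in>T. add_submonoid B" by blast
  then show "add_submonoid (\<Inter>T)"
    unfolding add_submonoid_def by (intro conjI allI ballI InterI; meson InterD)
qed

text \<open>
  Removing an atom from a monoid leaves a submonoid, so generators avoiding the atom cannot reach it.
\<close>

lemma atoms_subset_generators:
  assumes "add_submonoid M" and "add_submonoid hull H = M"
  shows "atoms M \<subseteq> H"
proof
  fix x assume x: "x \<in> atoms M"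
  show "x \<in> H"
  proof (rule ccontr)
    assume "x \<notin> H"
    then have "H \<subseteq> M - {x}"
      using assms(2) hull_subset[of H add_submonoid] by blast
    moreover have "add_submonoid (M - {x})"
      using assms(1) x by (fastforce simp: add_submonoid_def atoms_def)
    ultimately have "M \<subseteq> M - {x}"
      using hull_minimal[of H "M - {x}" add_submonoid] assms(2) by simp
    then show False
      using x by (auto simp: atoms_def)
  qed
qed

text \<open>
  An additive size that vanishes only at \<open>0\<close> strictly decreases in every proper decomposition, so
  decomposing stops at atoms.
\<close>

lemma atoms_generate:
  fixes deg :: "'m::monoid_add \<Rightarrow> nat"
  assumes "add_submonoid M"
    and deg_add: "\<And>x y. x \<in> M \<Longrightarrow> y \<in> M \<Longrightarrow> deg (x + y) = deg x + deg y"
    and deg_0: "\<And>x. x \<in> M \<Longrightarrow> deg x = 0 \<Longrightarrow> x = 0"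
  shows "add_submonoid hull (atoms M) = M"
proof
  show "add_submonoid hull (atoms M) \<subseteq> M"
    using assms(1) by (intro hull_minimal) (auto simp: atoms_def)
  have "x \<in> add_submonoid hull (atoms M)" if "x \<in> M" for x
    using that
  proof (induction "deg x" arbitrary: x rule: less_induct)
    case less
    consider "x = 0" | "x \<in> atoms M" | y z where "y \<in> M" "z \<in> M" "x = y + z" "y \<noteq> 0" "z \<noteq> 0"
      using less.prems by (auto simp: atoms_def)
    then show ?case
    proof cases
      case 1
      then show ?thesis using add_submonoid_hull[of "atoms M"] by (simp add: add_submonoid_def)
    next
      case 2
      then show ?thesis by (rule hull_inc)
    next
      case 3
      then have "deg y < deg x" "deg z < deg x"
        using deg_add deg_0 by (metis less_add_same_cancel1 less_add_same_cancel2 not_gr_zero)+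
      then show ?thesis
        using less.hyps 3 add_submonoid_hull[of "atoms M"] by (simp add: add_submonoid_def)
    qed
  qed
  then show "M \<subseteq> add_submonoid hull (atoms M)" by blast
qed

text \<open>
  Atoms lie in every generating set; if they also generate, they are the least generating set, hence
  the only minimal one.
\<close>

lemma hilbert_basis_eq_atoms:
  assumes "add_submonoid M" and "finite (atoms M)" and "add_submonoid hull (atoms M) = M"
  shows "hilbert_basis M = atoms M"
  unfolding hilbert_basis_def
proof (rule the_equality)
  show "finite (atoms M) \<and> add_submonoid hull (atoms M) = M \<and>
      (\<forall>H'. H' \<subset> atoms M \<longrightarrow> add_submonoid hull H' \<noteq> M)"
    using assms atoms_subset_generators[OF assms(1)] by blast
next
  fix H
  assume "finite H \<and> add_submonoid hull H = M \<and> (\<forall>H'. H' \<subset> H \<longrightarrow> add_submonoid hull H' \<noteq> M)"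
  then show "H = atoms M"
    using assms(3) atoms_subset_generators[OF assms(1), of H] by blast
qed


section \<open>Plane cones\<close>

text \<open>
  Fan cones are handled through their two ray generators, so that facts about one cone do not refer
  to the strings that define the fan.
\<close>

definition cone_span :: "nat \<times> nat \<Rightarrow> nat \<times> nat \<Rightarrow> (real \<times> real) set" where
  "cone_span g h =
    {(l1 * real (fst g) + l2 * real (fst h), l1 * real (snd g) + l2 * real (snd h)) | l1 l2.
      l1 \<ge> 0 \<and> l2 \<ge> 0}"

lemma mem_cone_lattice_points_iff:
  "(r, s) \<in> lattice_points (cone_span g h) \<longleftrightarrow>
    (\<exists>l1 l2. l1 \<ge> 0 \<and> l2 \<ge> 0 \<and>
      real_of_int r = l1 * real (fst g) + l2 * real (fst h) \<and>
      real_of_int s = l1 * real (snd g) + l2 * real (snd h))"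
  unfolding lattice_points_def cone_span_def mem_Collect_eq prod.case prod.inject by blast

lemma cone_spanE:
  assumes "(r, s) \<in> lattice_points (cone_span g h)"
  obtains l1 l2 where "l1 \<ge> 0" "l2 \<ge> 0"
    "of_int r = l1 * real (fst g) + l2 * real (fst h)"
    "of_int s = l1 * real (snd g) + l2 * real (snd h)"
  using assms unfolding mem_cone_lattice_points_iff by blast

lemma cone_spanI:
  assumes "l1 \<ge> 0" "l2 \<ge> 0"
    "of_int r = l1 * real (fst g) + l2 * real (fst h)"
    "of_int s = l1 * real (snd g) + l2 * real (snd h)"
  shows "(r, s) \<in> lattice_points (cone_span g h)"
  using assms unfolding mem_cone_lattice_points_iff by blast

text \<open>
  All inequalities that hold throughout a cone are obtained by testing a linear form on the two rays.
\<close>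

lemma linear_form_nonneg_on_cone:
  assumes "(r, s) \<in> lattice_points (cone_span g h)"
    and "\<alpha> * real (fst g) + \<beta> * real (snd g) \<ge> 0"
    and "\<alpha> * real (fst h) + \<beta> * real (snd h) \<ge> 0"
  shows "\<alpha> * of_int r + \<beta> * of_int s \<ge> (0::real)"
proof -
  obtain l1 l2 where l: "l1 \<ge> 0" "l2 \<ge> 0"
    and rs: "of_int r = l1 * real (fst g) + l2 * real (fst h)"
      "of_int s = l1 * real (snd g) + l2 * real (snd h)"
    using cone_spanE[OF assms(1)] by blast
  have "0 \<le> l1 * (\<alpha> * real (fst g) + \<beta> * real (snd g)) + l2 * (\<alpha> * real (fst h) + \<beta> * real (snd h))"
    by (intro add_nonneg_nonneg mult_nonneg_nonneg l assms(2,3))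
  also have "\<dots> = \<alpha> * of_int r + \<beta> * of_int s"
    unfolding rs by algebra
  finally show ?thesis .
qed

lemma cone_lattice_points_nonneg:
  assumes "(r, s) \<in> lattice_points (cone_span g h)"
  shows "r \<ge> 0" "s \<ge> 0"
  using linear_form_nonneg_on_cone[OF assms, of 1 0] linear_form_nonneg_on_cone[OF assms, of 0 1]
  by auto

lemma add_submonoid_cone: "add_submonoid (lattice_points (cone_span g h))"
proof -
  have "(0, 0) \<in> lattice_points (cone_span g h)"
    by (rule cone_spanI[of 0 0]) auto
  moreover have "(r + r', s + s') \<in> lattice_points (cone_span g h)"
    if rs: "(r, s) \<in> lattice_points (cone_span g h)" "(r', s') \<in> lattice_points (cone_span g h)"
    for r s r' s'
  proof -
    obtain l1 l2 where "l1 \<ge> 0" "l2 \<ge> 0"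
      "of_int r = l1 * real (fst g) + l2 * real (fst h)"
      "of_int s = l1 * real (snd g) + l2 * real (snd h)"
      using cone_spanE[OF rs(1)] by blast
    moreover obtain m1 m2 where "m1 \<ge> 0" "m2 \<ge> 0"
      "of_int r' = m1 * real (fst g) + m2 * real (fst h)"
      "of_int s' = m1 * real (snd g) + m2 * real (snd h)"
      using cone_spanE[OF rs(2)] by blast
    ultimately show ?thesis
      by (intro cone_spanI[of "l1 + m1" "l2 + m2"]) (auto simp: algebra_simps)
  qed
  ultimately show ?thesis
    by (auto simp: add_submonoid_def zero_prod_def)
qed

lemma cone_span_commute: "cone_span g h = cone_span h g"
  unfolding cone_span_def by (force simp: add.commute)

text \<open>
  If the coefficient of \<open>g\<close> exceeds 1, then subtracting \<open>g\<close> stays in the cone, and an atom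
  decomposed as \<open>g\<close> plus a remainder has remainder \<open>0\<close>.
\<close>

lemma cone_atom_coefficient_le:
  assumes atom: "(r, s) \<in> atoms (lattice_points (cone_span g h))"
    and g: "g \<noteq> (0, 0)"
    and l: "l1 \<ge> 0" "l2 \<ge> 0"
    and rs: "of_int r = l1 * real (fst g) + l2 * real (fst h)"
      "of_int s = l1 * real (snd g) + l2 * real (snd h)"
  shows "(r, s) = (int (fst g), int (snd g)) \<or> l1 \<le> 1"
proof (rule disjCI)
  assume "\<not> l1 \<le> 1"
  let ?M = "lattice_points (cone_span g h)"
  let ?g = "(int (fst g), int (snd g))"
  have "?g \<in> ?M"
    by (rule cone_spanI[of 1 0]) auto
  moreover have "(r - int (fst g), s - int (snd g)) \<in> ?M"
    using \<open>\<not> l1 \<le> 1\<close> l rs by (intro cone_spanI[of "l1 - 1" l2]) (auto simp: algebra_simps)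
  moreover have "(r, s) = ?g + (r - int (fst g), s - int (snd g))"
    by simp
  ultimately have "?g = 0 \<or> (r - int (fst g), s - int (snd g)) = 0"
    using atom unfolding atoms_def by blast
  then show "(r, s) = ?g"
    using g by (auto simp: zero_prod_def prod_eq_iff)
qed

text \<open>
  Gordan's lemma for plane cones: both coefficients of an atom are at most 1, apart from the
  generators themselves, so all atoms lie in the box with opposite corners \<open>0\<close> and \<open>g + h\<close>.
\<close>

lemma finite_cone_atoms:
  assumes "g \<noteq> (0, 0)" and "h \<noteq> (0, 0)"
  shows "finite (atoms (lattice_points (cone_span g h)))"
proof (rule finite_subset)
  let ?M = "lattice_points (cone_span g h)"
  show "atoms ?M \<subseteq> {0..int (fst g + fst h)} \<times> {0..int (snd g + snd h)}"
  proof
    fix x assume x: "x \<in> atoms ?M"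
    obtain r s where rs: "x = (r, s)" by force
    have M: "(r, s) \<in> ?M"
      using x by (simp add: rs atoms_def)
    obtain l1 l2 where l: "l1 \<ge> 0" "l2 \<ge> 0"
      and r: "of_int r = l1 * real (fst g) + l2 * real (fst h)"
      and s: "of_int s = l1 * real (snd g) + l2 * real (snd h)"
      using cone_spanE[OF M] by blast
    have "(r, s) = (int (fst g), int (snd g)) \<or> l1 \<le> 1"
      using cone_atom_coefficient_le[OF _ assms(1) l r s] x rs by simp
    moreover have "(r, s) = (int (fst h), int (snd h)) \<or> l2 \<le> 1"
      using cone_atom_coefficient_le[OF _ assms(2) l(2,1), of r s g] x rs r s
      by (simp add: cone_span_commute[of h g] add.commute)
    moreover have "r \<le> int (fst g + fst h) \<and> s \<le> int (snd g + snd h)" if "l1 \<le> 1" "l2 \<le> 1"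
    proof -
      have bound: "l1 * real m + l2 * real k \<le> real (m + k)" for m k
        using mult_right_mono[OF that(1), of "real m"] mult_right_mono[OF that(2), of "real k"]
        by simp
      have "real_of_int r \<le> real (fst g + fst h)" "real_of_int s \<le> real (snd g + snd h)"
        unfolding r s by (rule bound)+
      then show ?thesis by linarith
    qed
    ultimately show "x \<in> {0..int (fst g + fst h)} \<times> {0..int (snd g + snd h)}"
      using cone_lattice_points_nonneg[OF M] by (auto simp: rs)
  qed
qed simp

lemma hilbert_basis_cone_generates:
  assumes "g \<noteq> (0, 0)" and "h \<noteq> (0, 0)"
  shows "add_submonoid hull (hilbert_basis (lattice_points (cone_span g h))) =
    lattice_points (cone_span g h)"
proof -
  let ?M = "lattice_points (cone_span g h)"
  have "add_submonoid hull (atoms ?M) = ?M"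
  proof (rule atoms_generate[where deg = "\<lambda>x. nat (fst x + snd x)"])
    show "nat (fst (x + y) + snd (x + y)) = nat (fst x + snd x) + nat (fst y + snd y)"
      if "x \<in> ?M" "y \<in> ?M" for x y
      using that cone_lattice_points_nonneg[of "fst x" "snd x" g h]
        cone_lattice_points_nonneg[of "fst y" "snd y" g h] by simp
    show "x = 0" if "x \<in> ?M" "nat (fst x + snd x) = 0" for x
      using that cone_lattice_points_nonneg[of "fst x" "snd x" g h]
      by (simp add: zero_prod_def prod_eq_iff)
  qed (rule add_submonoid_cone)
  then show ?thesis
    using hilbert_basis_eq_atoms[OF add_submonoid_cone finite_cone_atoms[OF assms]] by simp
qed

text \<open>
  A point between the two rays lies in the cone: its coefficients come from Cramer's rule. If the
  determinant vanishes, the two rays coincide, and the inequalities force the point onto that ray.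
\<close>

lemma cone_lattice_pointI:
  fixes r s :: nat
  assumes g: "g \<noteq> (0, 0)" and h: "h \<noteq> (0, 0)"
    and gh: "fst g * snd h \<le> snd g * fst h"
    and rg: "fst g * s \<le> snd g * r" and rh: "snd h * r \<le> fst h * s"
  shows "(int r, int s) \<in> lattice_points (cone_span g h)"
proof -
  obtain b a d c where gh_def: "g = (b, a)" "h = (d, c)" by fastforce
  define D where "D = real a * real d - real b * real c"
  have le: "real b * s \<le> real a * r" "real c * r \<le> real d * s" "real b * c \<le> real a * d"
    using rg rh gh unfolding gh_def by (simp_all flip: of_nat_mult)
  show ?thesis
  proof (cases "D = 0")
    case False
    then have "D > 0" using le(3) by (simp add: D_def)
    \<comment> \<open>Cramer's rule for \<open>l1 (b, a) + l2 (d, c) = (r, s)\<close>\<close>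
    define l1 where "l1 = (real d * real s - real c * real r) / D"
    define l2 where "l2 = (real a * real r - real b * real s) / D"
    have "real r * D = (real d * real s - real c * real r) * real b + (real a * real r - real b * real s) * real d"
      "real s * D = (real d * real s - real c * real r) * real a + (real a * real r - real b * real s) * real c"
      unfolding D_def by algebra+
    then have r: "real r = l1 * real b + l2 * real d" and s: "real s = l1 * real a + l2 * real c"
      using \<open>D > 0\<close> by (simp_all add: l1_def l2_def add_divide_distrib[symmetric] nonzero_eq_divide_eq)
    have "l1 \<ge> 0" "l2 \<ge> 0"
      using le \<open>D > 0\<close> by (simp_all add: l1_def l2_def)
    then show ?thesis
      using r s by (intro cone_spanI[of l1 l2]) (simp_all only: gh_def fst_conv snd_conv of_int_of_nat_eq)
  next
    case True
    have eq: "real a * r = real b * s"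
    proof (cases "b = 0")
      case True
      with g \<open>D = 0\<close> have "d = 0" by (simp add: D_def gh_def)
      with h le have "r = 0" by (simp add: gh_def mult_le_0_iff)
      with True show ?thesis by simp
    next
      case False
      have "d \<noteq> 0"
      proof
        assume "d = 0"
        with \<open>D = 0\<close> False have "c = 0" by (simp add: D_def)
        with \<open>d = 0\<close> h show False by (simp add: gh_def)
      qed
      have "real a * real r * real d = real b * (real c * real r)"
        using \<open>D = 0\<close> unfolding D_def by algebra
      also have "\<dots> \<le> real b * (real d * real s)"
        by (rule mult_left_mono[OF le(2)]) simp
      also have "\<dots> = real b * real s * real d"
        by (simp only: mult_ac)
      finally have "real a * r \<le> real b * s"
        using \<open>d \<noteq> 0\<close> by simp
      with le(1) show ?thesis by simp
    qed
    show ?thesis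
    proof (cases "b = 0")
      case True
      with g eq show ?thesis
        by (intro cone_spanI[of "s / a" 0]) (auto simp: gh_def)
    next
      case False
      with eq show ?thesis
        by (intro cone_spanI[of "r / b" 0]) (auto simp: gh_def field_simps)
    qed
  qed
qed


section \<open>The fan\<close>

text \<open>
  In the degenerate case \<open>d = 0 < c\<close> the ratio \<open>c / d\<close> is infinite, which forces \<open>b = 0\<close>.
\<close>

lemma ennreal_ratio_cross_mult_le:
  assumes "of_nat a / of_nat b \<ge> (of_nat c / of_nat d :: ennreal)"
  shows "c * b \<le> a * d"
proof (cases "b = 0 \<or> d = 0")
  case True
  then show ?thesis
    using assms
    by (auto simp: ennreal_divide_eq_top_iff top_unique split: if_splits)
next
  case False
  then have "ennreal (real c / real d) \<le> ennreal (real a / real b)"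
    using assms(1) by (simp add: ennreal_of_nat_eq_real_of_nat divide_ennreal)
  then have "real c / real d \<le> real a / real b"
    by (simp add: ennreal_le_iff)
  then have "real c * real b \<le> real a * real d"
    using False by (simp add: field_simps)
  then show ?thesis
    by (simp flip: of_nat_mult)
qed

text \<open>
  The order of slopes for arbitrary pairs of rays, including the two axes. Transitivity is taken from
  the ratios, since cross products alone are not transitive across zero vectors.
\<close>

lemma fan_ordered_cross_mult_le:
  assumes "fan_ordered n a b" and "j \<le> k" and "k \<le> n + 1"
  shows "extend_a n a k * extend_b n b j \<le> extend_a n a j * extend_b n b k"
proof (cases "j = 0 \<or> k = n + 1")
  case True
  then show ?thesis
    by (auto simp: extend_a_def extend_b_def)
next
  case False
  then have "1 \<le> j" "k \<le> n"
    using assms by auto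
  have "of_nat (a k) / of_nat (b k) \<le> (of_nat (a j) / of_nat (b j) :: ennreal)"
    using assms(2) \<open>k \<le> n\<close>
  proof (induction k rule: dec_induct)
    case (step m)
    have "of_nat (a (Suc m)) / of_nat (b (Suc m)) \<le> (of_nat (a m) / of_nat (b m) :: ennreal)"
      using assms(1) \<open>1 \<le> j\<close> step by (auto simp: fan_ordered_def)
    with step show ?case by simp
  qed simp
  then show ?thesis
    using ennreal_ratio_cross_mult_le False assms by (auto simp: extend_a_def extend_b_def)
qed

lemma fan_cone_eq_cone_span:
  "fan_cone n a b i =
    cone_span (extend_b n b i, extend_a n a i) (extend_b n b (i + 1), extend_a n a (i + 1))"
  by (simp add: fan_cone_def cone_span_def)

lemma extend_nonzero:
  assumes "fan_ordered n a b" and "i \<le> n + 1"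
  shows "(extend_b n b i, extend_a n a i) \<noteq> (0, 0)"
proof (cases "i \<in> {1..n}")
  case True
  with assms(1) have "\<not> (a i = 0 \<and> b i = 0)"
    by (auto simp only: fan_ordered_def)
  with True show ?thesis by (auto simp: extend_a_def extend_b_def)
next
  case False
  with assms(2) have "i = 0 \<or> i = n + 1" by auto
  then show ?thesis by (auto simp: extend_a_def extend_b_def)
qed

text \<open>
  Rays turn clockwise from the vertical axis (ray \<open>0\<close>) to the horizontal axis (ray \<open>n + 1\<close>). The
  point lies between the last ray \<open>i \<le> n\<close> that it is on or below, which is the condition
  \<open>b i * s \<le> a i * r\<close>, and the ray that follows.
\<close>

lemma fan_covers_quadrant:
  fixes r s :: nat
  assumes "fan_ordered n a b"
  shows "\<exists>i\<le>n. (int r, int s) \<in> lattice_points (fan_cone n a b i)"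
proof -
  let ?A = "extend_a n a" and ?B = "extend_b n b"
  let ?P = "\<lambda>i. i \<le> n \<and> ?B i * s \<le> ?A i * r"
  have "?P 0"
    by (simp add: extend_a_def extend_b_def)
  then obtain i where i: "?P i" and max: "\<And>j. ?P j \<Longrightarrow> j \<le> i"
    using GreatestI_nat[of ?P 0 n] Greatest_le_nat[of ?P _ n] by blast
  have next_ray: "?A (i + 1) * r \<le> ?B (i + 1) * s"
  proof (cases "i = n")
    case True
    then show ?thesis by (simp add: extend_a_def)
  next
    case False
    with i max[of "i + 1"] show ?thesis by fastforce
  qed
  have "(int r, int s) \<in> lattice_points (fan_cone n a b i)"
    unfolding fan_cone_eq_cone_span
  proof (rule cone_lattice_pointI)
    show "(?B i, ?A i) \<noteq> (0, 0)" "(?B (i + 1), ?A (i + 1)) \<noteq> (0, 0)"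
      using i by (auto intro!: extend_nonzero[OF assms] simp del: prod.inject)
  qed (use i next_ray fan_ordered_cross_mult_le[OF assms, of i "i + 1"] in \<open>simp_all add: mult.commute\<close>)
  with i show ?thesis by blast
qed

text \<open>
  The form \<open>a k * r - b k * s\<close> vanishes on ray \<open>k\<close>, so its sign on \<open>C i\<close> only depends on the side of
  ray \<open>k\<close> on which rays \<open>i\<close> and \<open>i + 1\<close> lie.
\<close>

lemma fan_cone_max_exponent:
  fixes r s :: nat
  assumes "fan_ordered n a b" and "i \<le> n" and k: "k \<in> {1..n}"
    and rs: "(int r, int s) \<in> lattice_points (fan_cone n a b i)"
  shows "max (a k * r) (b k * s) = (if k \<le> i then a k * r else b k * s)"
proof -
  let ?A = "extend_a n a" and ?B = "extend_b n b"
  have ext: "?A k = a k" "?B k = b k"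
    using k by (auto simp: extend_a_def extend_b_def)
  have cross: "real (?A m) * real (?B j) \<le> real (?A j) * real (?B m)" if "j \<le> m" "m \<le> n + 1" for j m
    using fan_ordered_cross_mult_le[OF assms(1) that] by (simp flip: of_nat_mult)
  note form = linear_form_nonneg_on_cone[OF rs[unfolded fan_cone_eq_cone_span]]
  show ?thesis
  proof (cases "k \<le> i")
    case True
    have "0 \<le> real (a k) * of_int (int r) + (- real (b k)) * of_int (int s)"
      using True assms(2) cross[of k i] cross[of k "i + 1"]
      by (intro form) (simp_all add: ext mult.commute)
    then have "b k * s \<le> a k * r"
      by (simp flip: of_nat_mult)
    with True show ?thesis by simp
  next
    case False
    have "0 \<le> (- real (a k)) * of_int (int r) + real (b k) * of_int (int s)"
      using False k cross[of i k] cross[of "i + 1" k]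
      by (intro form) (simp_all add: ext mult.commute)
    then have "a k * r \<le> b k * s"
      by (simp flip: of_nat_mult)
    with False show ?thesis by simp
  qed
qed


section \<open>Generators of the intersection algebra\<close>

text \<open>
  With \<open>i\<close> fixed the exponents are linear in \<open>(r, s)\<close>; this is defined on the whole quadrant, and is
  the lcm term exactly where \<open>i\<close> selects the larger exponents.
\<close>

definition fan_monomial ::
  "(nat \<Rightarrow> 'a::comm_ring_1) \<Rightarrow> nat \<Rightarrow> (nat \<Rightarrow> nat) \<Rightarrow> (nat \<Rightarrow> nat) \<Rightarrow> nat \<Rightarrow> int \<times> int \<Rightarrow> 'a poly_uv"
where
  "fan_monomial p n a b i = (\<lambda>(r, s).
    term_uv ((\<Prod>k=1..i. p k ^ (a k * nat r)) * (\<Prod>k=i+1..n. p k ^ (b k * nat s))) (nat r) (nat s))"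

lemma fan_monomial_add:
  assumes "r \<ge> 0" "s \<ge> 0" "r' \<ge> 0" "s' \<ge> 0"
  shows "fan_monomial p n a b i ((r, s) + (r', s')) =
    fan_monomial p n a b i (r, s) * fan_monomial p n a b i (r', s')"
proof -
  have "(\<Prod>k\<in>K. p k ^ (c k * (l + m))) = (\<Prod>k\<in>K. p k ^ (c k * l)) * (\<Prod>k\<in>K. p k ^ (c k * m))"
    for K and c :: "nat \<Rightarrow> nat" and l m
    by (simp only: distrib_left power_add prod.distrib)
  then show ?thesis
    unfolding fan_monomial_def add_Pair prod.case term_uv_mult
      nat_add_distrib[OF assms(1,3)] nat_add_distrib[OF assms(2,4)]
    by (simp only: mult_ac)
qed

lemma fan_monomial_eq_max:
  fixes r s :: nat
  assumes "fan_ordered n a b" and "i \<le> n"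
    and "(int r, int s) \<in> lattice_points (fan_cone n a b i)"
  shows "fan_monomial p n a b i (int r, int s) =
    term_uv (\<Prod>k=1..n. p k ^ max (a k * r) (b k * s)) r s"
proof -
  have split: "{1..n} = {1..i} \<union> {i+1..n}"
    using assms(2) by auto
  have "(\<Prod>k=1..n. p k ^ max (a k * r) (b k * s)) =
      (\<Prod>k=1..n. p k ^ (if k \<le> i then a k * r else b k * s))"
    using fan_cone_max_exponent[OF assms(1,2) _ assms(3)] by (intro prod.cong) auto
  also have "\<dots> = (\<Prod>k=1..i. p k ^ (if k \<le> i then a k * r else b k * s)) *
      (\<Prod>k=i+1..n. p k ^ (if k \<le> i then a k * r else b k * s))"
    unfolding split by (rule prod.union_disjoint) auto
  also have "\<dots> = (\<Prod>k=1..i. p k ^ (a k * r)) * (\<Prod>k=i+1..n. p k ^ (b k * s))"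
    by simp
  finally show ?thesis
    by (simp add: fan_monomial_def)
qed

text \<open>
  The lattice points of \<open>C i\<close> whose term lies in \<open>B\<close> form a submonoid, by multiplicativity of the
  terms, and this submonoid contains the Hilbert basis.
\<close>

lemma fan_monomials_mem_subalgebra:
  assumes "fan_ordered n a b" and "i \<le> n" and B: "subalgebra_uv B"
    and basis: "\<And>x. x \<in> hilbert_basis (lattice_points (fan_cone n a b i)) \<Longrightarrow> fan_monomial p n a b i x \<in> B"
    and x: "x \<in> lattice_points (fan_cone n a b i)"
  shows "fan_monomial p n a b i x \<in> B"
proof -
  let ?M = "lattice_points (fan_cone n a b i)"
  have hull: "add_submonoid hull (hilbert_basis ?M) = ?M"
    unfolding fan_cone_eq_cone_span
    using assms(2) by (intro hilbert_basis_cone_generates extend_nonzero[OF assms(1)]) auto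
  let ?T = "{x \<in> ?M. fan_monomial p n a b i x \<in> B}"
  have "add_submonoid ?T"
    unfolding add_submonoid_def
  proof (intro conjI ballI)
    have M: "add_submonoid ?M"
      unfolding fan_cone_eq_cone_span by (rule add_submonoid_cone)
    then show "0 \<in> ?T"
      using B by (simp add: add_submonoid_def subalgebra_uv_def fan_monomial_def zero_prod_def)
    fix x y assume "x \<in> ?T" "y \<in> ?T"
    then have "x + y \<in> ?M" "fan_monomial p n a b i x * fan_monomial p n a b i y \<in> B"
      using M B unfolding add_submonoid_def subalgebra_uv_def by blast+
    moreover have "fan_monomial p n a b i (x + y) = fan_monomial p n a b i x * fan_monomial p n a b i y"
    proof -
      have nonneg: "fst z \<ge> 0 \<and> snd z \<ge> 0" if z: "z \<in> ?T" for z
        using z cone_lattice_points_nonneg[of "fst z" "snd z"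
            "(extend_b n b i, extend_a n a i)" "(extend_b n b (i + 1), extend_a n a (i + 1))"]
        by (simp add: fan_cone_eq_cone_span)
      show ?thesis
        using nonneg[OF \<open>x \<in> ?T\<close>] nonneg[OF \<open>y \<in> ?T\<close>]
          fan_monomial_add[of "fst x" "snd x" "fst y" "snd y" p n a b i] by simp
    qed
    ultimately show "x + y \<in> ?T"
      by simp
  qed
  moreover have "hilbert_basis ?M \<subseteq> ?T"
    using basis hull hull_subset[of "hilbert_basis ?M" add_submonoid] by auto
  ultimately have "?M \<subseteq> ?T"
    using hull_minimal[of "hilbert_basis ?M" ?T add_submonoid] hull by simp
  with x show ?thesis by blast
qed

theorem theorem2p8:
  fixes p :: "nat \<Rightarrow> 'a::ufd"
    and a b :: "nat \<Rightarrow> nat"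
    and n :: nat
    and I J :: "'a set"
    and C :: "nat \<Rightarrow> (real \<times> real) set"
    and Q :: "nat \<Rightarrow> (int \<times> int) set"
  assumes "noetherian TYPE('a)"
    and "n \<ge> 1"
    and "\<And>i. i \<in> {1..n} \<Longrightarrow> irreducible (p i)"
    and "\<And>i j. i \<in> {1..n} \<Longrightarrow> j \<in> {1..n} \<Longrightarrow> i \<noteq> j \<Longrightarrow> \<not> (p i ddvd p j)"
    and "fan_ordered n a b"
    and "I = ideal_span {\<Prod>k=1..n. p k ^ a k}"
    and "J = ideal_span {\<Prod>k=1..n. p k ^ b k}"
    and "\<And>i. i \<le> n \<Longrightarrow> C i = fan_cone n a b i"
    and "\<And>i. i \<le> n \<Longrightarrow> Q i = lattice_points (C i)"
  shows "intersection_algebra I J =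
    subalgebra_uv hull
      {term_uv ((\<Prod>k=1..i. p k ^ (a k * nat r)) * (\<Prod>k=i+1..n. p k ^ (b k * nat s))) (nat r) (nat s)
        | i r s. i \<le> n \<and> (r, s) \<in> hilbert_basis (Q i)}"
    (is "?B = subalgebra_uv hull ?S")
proof
  have S: "?S = {fan_monomial p n a b i x | i x. i \<le> n \<and> x \<in> hilbert_basis (lattice_points (fan_cone n a b i))}"
    using assms(8,9) by (fastforce simp: fan_monomial_def)
  \<comment> \<open>Between irreducible elements divisibility already means association.\<close>
  have not_dvd: "\<not> p j dvd p k" if jk: "j \<in> {1..n}" "k \<in> {1..n}" "j \<noteq> k" for j k
  proof
    assume "p j dvd p k"
    then obtain c where c: "p k = p j * c" by (auto simp: dvd_def)
    then have "c dvd 1"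
      using assms(3)[OF jk(1)] assms(3)[OF jk(2)] by (auto simp: irreducible_def)
    then have "p k dvd p j"
      by (simp add: c mult_unit_dvd_iff)
    with \<open>p j dvd p k\<close> assms(4)[OF jk] show False by simp
  qed
  have coeffs: "ideal_power I r \<inter> ideal_power J s = {x. (\<Prod>k=1..n. p k ^ max (a k * r) (b k * s)) dvd x}" for r s
    unfolding assms(6,7) using assms(3) not_dvd
    by (intro principal_powers_inter) auto
  show "subalgebra_uv hull ?S \<subseteq> ?B"
  proof (rule hull_minimal)
    show "?S \<subseteq> ?B"
    proof
      fix f assume "f \<in> ?S"
      then obtain i x where i: "i \<le> n" and x: "x \<in> hilbert_basis (lattice_points (fan_cone n a b i))"
        and f: "f = fan_monomial p n a b i x"
        unfolding S by blast
      have "x \<in> lattice_points (fan_cone n a b i)"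
        using hull_inc[OF x, of add_submonoid] i
          hilbert_basis_cone_generates[OF extend_nonzero[OF assms(5)] extend_nonzero[OF assms(5)]]
        by (simp add: fan_cone_eq_cone_span)
      moreover from this obtain r s where rs: "x = (int r, int s)"
        using cone_lattice_points_nonneg[of "fst x" "snd x"]
        unfolding fan_cone_eq_cone_span by (metis nonneg_int_cases prod.collapse)
      ultimately have "f = term_uv (\<Prod>k=1..n. p k ^ max (a k * r) (b k * s)) r s"
        using fan_monomial_eq_max[OF assms(5) i] by (simp add: f)
      then show "f \<in> ?B"
        using coeffs[of r s] by (auto intro: term_uv_mem_intersection_algebra)
    qed
  qed (rule subalgebra_uv_intersection_algebra)
  show "?B \<subseteq> subalgebra_uv hull ?S"
  proof
    let ?H = "subalgebra_uv hull ?S"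
    fix f assume f: "f \<in> ?B"
    have "term_uv c r s \<in> ?H" if c: "c \<in> ideal_power I r \<inter> ideal_power J s" for c r s
    proof -
      obtain i where i: "i \<le> n" "(int r, int s) \<in> lattice_points (fan_cone n a b i)"
        using fan_covers_quadrant[OF assms(5)] by blast
      have "fan_monomial p n a b i x \<in> ?H" if "x \<in> hilbert_basis (lattice_points (fan_cone n a b i))" for x
        using i(1) that unfolding S by (intro hull_inc) blast
      then have "fan_monomial p n a b i (int r, int s) \<in> ?H"
        by (rule fan_monomials_mem_subalgebra[OF assms(5) i(1) subalgebra_uv_hull _ i(2)])
      moreover obtain d where "c = d * (\<Prod>k=1..n. p k ^ max (a k * r) (b k * s))"
        using c by (auto simp: coeffs dvd_def mult.commute)
      then have "term_uv c r s = term_uv d 0 0 * fan_monomial p n a b i (int r, int s)"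
        by (simp only: fan_monomial_eq_max[OF assms(5) i] term_uv_mult add_0)
      ultimately show ?thesis
        by (simp only: subalgebra_uv_scale[OF subalgebra_uv_hull])
    qed
    then have "(\<Sum>(r, s)\<in>Poly_Mapping.keys f. term_uv (Poly_Mapping.lookup f (r, s)) r s) \<in> ?H"
      using f by (auto simp: mem_intersection_algebra_iff intro!: sum_mem_subalgebra_uv[OF subalgebra_uv_hull])
    then show "f \<in> ?H"
      by (simp only: poly_uv_expand[symmetric])
  qed
qed

end
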